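(* Let $n\ge1$ and $s>0$. Then there exists a constant $c(s)>0$ such that for any $f,g\in\ell^2(\mathbb{Z}^n)$ and any measurable $\Sigma\subset\mathbb{Z}^n\times\mathbb{T}^n$ with $(\nu\otimes\mu)(\Sigma)<\infty$, $$\left\|V_gf\right\|_{L^2(\Sigma)}\le c(s)\left[(\nu\otimes\mu)(\Sigma)\right]^{\frac12}\left\||(m,w)|^sV_gf\right\|_{L^2(\mathbb{Z}^n\times\mathbb{T}^n)}.$$
   Context: For $f,g\in\ell^2(\mathbb{Z}^n)$ the short-time Fourier transform (STFT) of $f$ with window $g$ is the function on $\mathbb{Z}^n\times\mathbb{T}^n$ given by $V_gf(m,w)=\sum_{k\in\mathbb{Z}^n}f(k)\,\overline{g(k-m)}\,e^{-2\pi i w\cdot k}$. The measure $\nu\otimes\mu$ on $\mathbb{Z}^n\times\mathbb{T}^n$ is the product of the counting measure $\nu$ on $\mathbb{Z}^n$ and the Lebesgue measure $\mu$ on $\mathbb{T}^n$ (total mass $1$); $L^2(\mathbb{Z}^n\times\mathbb{T}^n)$ and $L^2(\Sigma)$ are taken with respect to $\nu\otimes\mu$. The torus $\mathbb{T}^n=\mathbb{R}^n/\mathbb{Z}^n$ is identified with $[-\tfrac12,\tfrac12)^n$, and $|(m,w)|=\sqrt{|m|^2+|w|^2}$ with Euclidean norms $|m|$, $|w|$. $|(m,w)|^sV_gf$ denotes the function $(m,w)\mapsto|(m,w)|^sV_gf(m,w)$, whose norm may be $+\infty$. The dimension $n$ is fixed, so $c(s)$ may depend on $n$. *)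

theory Defs
  imports "HOL-Analysis.Analysis"
begin

definition real_vec :: "int ^ 'n \<Rightarrow> real ^ 'n::finite" where
  "real_vec k = (\<chi> i. real_of_int (k $ i))"

definition ell2 :: "('a \<Rightarrow> complex) set" where
  "ell2 = {f. (\<lambda>k. (cmod (f k))\<^sup>2) summable_on UNIV}"

text \<open>The torus is represented by its fundamental domain; for \<open>w\<close> in it and integral \<open>k\<close>
  the character \<open>exp (-2 \<pi> i w \<bullet> k)\<close> does not depend on the choice of representatives.\<close>

definition torus :: "(real ^ 'n::finite) set" where
  "torus = {w. \<forall>i. - 1 / 2 \<le> w $ i \<and> w $ i < 1 / 2}"

text \<open>The first factor is countable with all subsets measurable, so a set is measurable for the
  product measure iff each of its slices in the torus is Lebesgue measurable.\<close>

definition phase_space :: "((int ^ 'n) \<times> (real ^ 'n::finite)) measure" where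
  "phase_space = count_space UNIV \<Otimes>\<^sub>M lebesgue_on torus"

definition STFT ::
    "(int ^ 'n \<Rightarrow> complex) \<Rightarrow> (int ^ 'n \<Rightarrow> complex) \<Rightarrow> (int ^ 'n) \<times> (real ^ 'n::finite) \<Rightarrow> complex"
  where
  "STFT g f = (\<lambda>(m, w). \<Sum>\<^sub>\<infinity>k\<in>UNIV. f k * cnj (g (k - m)) *
     exp (- 2 * complex_of_real pi * \<i> * complex_of_real (w \<bullet> real_vec k)))"

definition phase_norm :: "(int ^ 'n) \<times> (real ^ 'n::finite) \<Rightarrow> real" where
  "phase_norm = (\<lambda>(m, w). sqrt ((norm (real_vec m))\<^sup>2 + (norm w)\<^sup>2))"

definition ennsqrt :: "ennreal \<Rightarrow> ennreal" where
  "ennsqrt x = (if x = \<infinity> then \<infinity> else ennreal (sqrt (enn2real x)))"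

text \<open>Extended-valued: the norm is \<open>\<infinity>\<close> for a measurable function that is not square integrable.\<close>

definition L2_enorm :: "'a measure \<Rightarrow> ('a \<Rightarrow> complex) \<Rightarrow> ennreal" where
  "L2_enorm M F = ennsqrt (\<integral>\<^sup>+ x. ennreal ((cmod (F x))\<^sup>2) \<partial>M)"

end

theory Submission
  imports Defs
begin

text \<open>Write \<open>A = \<parallel>f\<parallel>\<^sup>2 \<parallel>g\<parallel>\<^sup>2\<close>. By Cauchy-Schwarz \<open>A\<close> bounds \<open>|V\<^sub>g f|\<^sup>2\<close> pointwise, and by
  Parseval it is the integral of \<open>|V\<^sub>g f|\<^sup>2\<close> over phase space (only \<open>\<le>\<close> is needed). The cube of points
  \<open>(0, w)\<close> with \<open>|w\<^sub>i| \<le> 1/4\<close> has measure at most \<open>1/2\<close> and so carries at most half of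
  this energy; off the cube \<open>|(m, w)| \<ge> 1/4\<close>. Hence \<open>A/2\<close> is at most \<open>4\<^bsup>2s\<^esup>\<close> times the weighted
  energy, while the energy on \<open>\<Sigma>\<close> is at most \<open>A\<close> times the measure of \<open>\<Sigma>\<close>.\<close>

section \<open>Orthogonality of characters on the torus\<close>

text \<open>Lebesgue measure is the image of the product measure on coordinates, so Fubini separates
  the variables. This reduces integrals of characters to one dimension.\<close>

lemma integral_lborel_prod:
  fixes f :: "'a::euclidean_space \<Rightarrow> real \<Rightarrow> 'b::{real_normed_field,banach,second_countable_topology}"
  assumes f: "\<And>b. b \<in> Basis \<Longrightarrow> integrable lborel (f b)"
  shows "(\<integral>x. (\<Prod>b\<in>Basis. f b (x \<bullet> b)) \<partial>lborel) = (\<Prod>b\<in>Basis. \<integral>t. f b t \<partial>lborel)"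
proof -
  interpret product_sigma_finite "\<lambda>_::'a. lborel :: real measure" ..
  have [measurable]: "f b \<in> borel_measurable borel" if "b \<in> Basis" for b
    using borel_measurable_integrable[OF f[OF that]] by simp
  have "(\<integral>x. (\<Prod>b\<in>Basis. f b (x \<bullet> b)) \<partial>lborel)
      = (\<integral>x. (\<Prod>b\<in>Basis. f b (x b)) \<partial>(\<Pi>\<^sub>M b\<in>Basis. lborel))"
    by (subst lborel_eq, subst integral_distr)
       (auto intro!: Bochner_Integration.integral_cong prod.cong)
  also have "\<dots> = (\<Prod>b\<in>Basis. \<integral>t. f b t \<partial>lborel)"
    by (rule product_integral_prod) (auto intro: f)
  finally show ?thesis .
qed

definition character :: "int ^ 'n \<Rightarrow> real ^ 'n::finite \<Rightarrow> complex" where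
  "character k w = cis (- 2 * pi * (w \<bullet> real_vec k))"

lemma exp_eq_character:
  "exp (- 2 * complex_of_real pi * \<i> * complex_of_real (w \<bullet> real_vec k)) = character k w"
  by (simp add: character_def cis_conv_exp mult_ac)

lemma cmod_character [simp]: "cmod (character k w) = 1"
  by (simp add: character_def)

lemma continuous_on_character [continuous_intros]: "continuous_on S (character k)"
  unfolding character_def by (intro continuous_intros)

lemma measurable_character [measurable]: "character k \<in> borel_measurable borel"
  by (intro borel_measurable_continuous_onI continuous_intros)

lemma real_vec_diff: "real_vec (k - l) = real_vec k - real_vec l"
  by (simp add: real_vec_def vec_eq_iff)

lemma character_diff: "character (k - l) w = character k w * cnj (character l w)"
  by (simp add: character_def real_vec_diff cis_cnj cis_mult algebra_simps)

lemma torus_sets [measurable]: "torus \<in> sets borel"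
  unfolding torus_def by measurable

lemma torus_lebesgue: "torus \<in> sets lebesgue"
  by (simp add: sets_completionI_sets)

text \<open>For \<open>a \<noteq> 0\<close> the primitive takes equal values at the two endpoints,
  which lie one full period apart. The interval is half-open to match \<open>torus\<close>.\<close>

lemma integral_cis_period:
  fixes a :: int
  shows "has_bochner_integral lborel (\<lambda>t::real. indicator {-1/2..<1/2} t *\<^sub>R cis (-2 * pi * (t * a)))
     (if a = 0 then 1 else 0)"
proof -
  \<comment> \<open>The fundamental theorem of calculus is applied on the closed interval; the extra
    endpoint \<open>1/2\<close> is a null set and is discarded at the end.\<close>
  have "has_bochner_integral lborel (\<lambda>t::real. indicator {-1/2..1/2} t *\<^sub>R cis (-2 * pi * (t * a)))
     (if a = 0 then 1 else 0)"
  proof (cases "a = 0")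
    case True
    have "has_bochner_integral lborel (indicator {-1/2..1/2::real}) (1::real)"
      using has_bochner_integral_real_indicator[of "{-1/2..1/2::real}" lborel] by simp
    from has_bochner_integral_of_real[OF this, where 'a=complex] show ?thesis
      using True by (simp add: scaleR_conv_of_real)
  next
    case False
    let ?F = "\<lambda>t::real. cis (-2 * pi * (t * a)) / (- (2 * pi * a) * \<i>)"
    have F: "(?F has_vector_derivative cis (-2 * pi * (t * a))) (at t within {-1/2..1/2})" for t :: real
    proof -
      have "((\<lambda>z. exp (\<i> * (-2 * pi * (z * a))) / (- (2 * pi * a) * \<i>)) has_field_derivative
          exp (\<i> * (-2 * pi * (of_real t * a)))) (at (of_real t))"
        using False by (auto intro!: derivative_eq_intros simp: field_simps)
      from has_vector_derivative_real_field[OF this] show ?thesis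
        by (simp add: cis_conv_exp)
    qed
    have "has_bochner_integral lborel (\<lambda>t. indicator {-1/2..1/2} t *\<^sub>R cis (-2 * pi * (t * a)))
        (?F (1/2) - ?F (-1/2))"
      by (rule has_bochner_integral_FTC_Icc[OF _ F]) (auto intro!: continuous_intros)
    moreover have "?F (1/2) - ?F (-1/2) = 0"
    proof -
      \<comment> \<open>Since \<open>a\<close> is an integer, the added angle is a whole number of
        turns.\<close>
      have "cis (- (pi * a)) = cis (- (pi * a)) * cis (2 * pi * a)"
        by (simp add: cis_multiple_2pi)
      also have "\<dots> = cis (pi * a)"
        by (simp add: cis_mult algebra_simps)
      finally have "cis (- (pi * a)) = cis (pi * a)" .
      then show ?thesis by simp
    qed
    ultimately show ?thesis using False by simp
  qed
  moreover have "AE t in lborel. indicator {-1/2..1/2} t *\<^sub>R cis (-2 * pi * (t * a))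
      = indicator {-1/2..<1/2} t *\<^sub>R cis (-2 * pi * (t * a))"
    using AE_lborel_singleton[of "1/2::real"] by eventually_elim (auto simp: indicator_def)
  moreover have [measurable]: "(\<lambda>t::real. cis (-2 * pi * (t * a))) \<in> borel_measurable borel"
    by (intro borel_measurable_continuous_onI continuous_intros)
  ultimately show ?thesis
    by (subst has_bochner_integral_cong_AE[symmetric]) simp_all
qed

text \<open>Used with \<open>r = 1/2\<close> to see that the torus has finite measure and with
  \<open>r = 1/4\<close> to measure the central cube.\<close>

lemma emeasure_cube:
  fixes r :: real
  assumes "r \<ge> 0"
  shows "emeasure lborel {w::real^'n::finite. \<forall>i. - r \<le> w $ i \<and> w $ i \<le> r} = ennreal ((2*r) ^ CARD('n))"
proof -
  have "{w::real^'n. \<forall>i. - r \<le> w $ i \<and> w $ i \<le> r} = cbox (\<chi> i. - r) (\<chi> i. r)"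
    by (auto simp: cbox_def Basis_vec_def inner_axis)
  moreover have "(\<Prod>b\<in>Basis. ((\<chi> i. r) - (\<chi> i. - r) :: real^'n) \<bullet> b) = (\<Prod>b\<in>(Basis::(real^'n) set). 2*r)"
    by (intro prod.cong) (auto simp: Basis_vec_def inner_axis)
  moreover have "(\<chi> i. - r) \<bullet> b \<le> (\<chi> i. r) \<bullet> b" if "b \<in> Basis" for b :: "real^'n"
    using that assms by (auto simp: Basis_vec_def inner_axis)
  ultimately show ?thesis
    by simp
qed

lemma finite_measure_torus: "finite_measure (lebesgue_on (torus :: (real^'n::finite) set))"
proof
  have "emeasure (lebesgue_on torus) (torus :: (real^'n) set) = emeasure lborel (torus :: (real^'n) set)"
    by (simp add: emeasure_restrict_space torus_lebesgue)
  also have "\<dots> \<le> emeasure lborel {w::real^'n. \<forall>i. - (1/2) \<le> w $ i \<and> w $ i \<le> 1/2}"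
    by (rule emeasure_mono) (auto simp: torus_def less_imp_le)
  also have "\<dots> = 1"
    by (subst emeasure_cube) auto
  finally show "emeasure (lebesgue_on torus) (space (lebesgue_on (torus :: (real^'n) set))) \<noteq> \<infinity>"
    by (auto simp: top_unique)
qed

text \<open>Both the character and the indicator of the torus factor over the coordinates, and a
  single coordinate with \<open>k $ i \<noteq> 0\<close> makes the whole product of integrals
  vanish.\<close>

lemma integral_character:
  "(\<integral>w. character k w \<partial>lebesgue_on torus) = (if k = (0::int^'n::finite) then 1 else 0)"
proof -
  \<comment> \<open>The factors are indexed by basis vectors, as \<open>integral_lborel_prod\<close>
    requires; at \<open>b = axis i 1\<close> the frequency is the integer
    \<open>k $ i\<close>.\<close>
  let ?\<phi> = "\<lambda>(b::real^'n) t::real. indicator {-1/2..<1/2} t *\<^sub>R cis (-2 * pi * (t * (real_vec k \<bullet> b)))"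
  have \<phi>: "has_bochner_integral lborel (?\<phi> (axis i 1)) (if k $ i = 0 then 1 else 0)" for i
    using integral_cis_period[of "k $ i"] by (simp add: inner_axis real_vec_def)
  have pt: "indicator torus w *\<^sub>R character k w = (\<Prod>b\<in>Basis. ?\<phi> b (w \<bullet> b))" for w :: "real^'n"
  proof -
    have "w \<bullet> real_vec k = (\<Sum>b\<in>Basis. (w \<bullet> b) * (real_vec k \<bullet> b))"
      by (rule euclidean_inner)
    then have "character k w = (\<Prod>b\<in>Basis. cis (-2 * pi * ((w \<bullet> b) * (real_vec k \<bullet> b))))"
      by (simp add: character_def cis_conv_exp sum_distrib_left flip: exp_sum)
    moreover have "(indicator torus w :: complex) = (\<Prod>b\<in>Basis. indicator {-1/2..<1/2} (w \<bullet> b))"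
    proof (cases "w \<in> torus")
      case True
      then have "(\<Prod>b\<in>Basis. indicator {-1/2..<1/2} (w \<bullet> b)) = (1::complex)"
        by (intro prod.neutral) (auto simp: torus_def Basis_vec_def inner_axis indicator_def)
      then show ?thesis using True by simp
    next
      case False
      then obtain i where "w $ i \<notin> {-1/2..<1/2}" by (auto simp: torus_def)
      then have "\<exists>b\<in>Basis. indicator {-1/2..<1/2} (w \<bullet> b) = (0::complex)"
        by (intro bexI[of _ "axis i 1"]) (auto simp: inner_axis axis_in_Basis_iff indicator_def)
      then show ?thesis using False by (simp add: prod_zero)
    qed
    ultimately show ?thesis
      by (simp add: scaleR_conv_of_real of_real_indicator prod.distrib)
  qed
  have "(\<integral>w. character k w \<partial>lebesgue_on torus) = (\<integral>w. indicator torus w *\<^sub>R character k w \<partial>lborel)"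
    by (simp add: integral_restrict_space torus_lebesgue integral_completion)
  also have "\<dots> = (\<integral>w. (\<Prod>b\<in>Basis. ?\<phi> b (w \<bullet> b)) \<partial>lborel)"
    by (simp only: pt)
  also have "\<dots> = (\<Prod>b\<in>Basis. \<integral>t. ?\<phi> b t \<partial>lborel)"
    by (rule integral_lborel_prod) (use \<phi> in \<open>auto simp: Basis_vec_def has_bochner_integral_iff\<close>)
  also have "\<dots> = (if k = 0 then 1 else 0)"
  proof (cases "k = 0")
    case True
    then show ?thesis
      using \<phi> by (auto intro!: prod.neutral simp: Basis_vec_def has_bochner_integral_iff)
  next
    case False
    then obtain i where "k $ i \<noteq> 0" by (auto simp: vec_eq_iff)
    then have "(\<integral>t. ?\<phi> (axis i 1) t \<partial>lborel) = 0"
      using \<phi>[of i] by (simp add: has_bochner_integral_iff)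
    then have "\<exists>b\<in>Basis. (\<integral>t. ?\<phi> b t \<partial>lborel) = 0"
      by (intro bexI[of _ "axis i 1"]) (auto simp: axis_in_Basis_iff)
    then show ?thesis using False by (simp add: prod_zero)
  qed
  finally show ?thesis .
qed

lemma measurable_lebesgue_on_torus:
  "f \<in> borel_measurable borel \<Longrightarrow> f \<in> borel_measurable (lebesgue_on (torus :: (real^'n::finite) set))"
  by (intro measurable_restrict_space1 measurable_completion) simp

lemma integrable_character: "integrable (lebesgue_on torus) (character (k::int^'n::finite))"
proof -
  interpret finite_measure "lebesgue_on (torus :: (real^'n) set)" by (rule finite_measure_torus)
  show ?thesis
    by (rule integrable_const_bound[where B=1]) (auto intro: measurable_lebesgue_on_torus)
qed

text \<open>The trivial character is constantly 1, so its integral is the total mass.\<close>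

lemma emeasure_torus: "emeasure (lebesgue_on torus) (torus :: (real^'n::finite) set) = 1"
proof -
  interpret finite_measure "lebesgue_on (torus :: (real^'n) set)" by (rule finite_measure_torus)
  have "complex_of_real (measure (lebesgue_on torus) (torus :: (real^'n) set)) = 1"
    using integral_character[of "0::int^'n"] by (simp add: character_def real_vec_def zero_vec_def[symmetric] scaleR_conv_of_real)
  then show ?thesis by (simp add: emeasure_eq_measure)
qed

text \<open>Parseval for finite sums: the squared modulus expands into a double sum of characters
  \<open>k - l\<close>, of which only the diagonal survives integration.\<close>

lemma nn_integral_trigonometric_poly:
  fixes h :: "int^'n::finite \<Rightarrow> complex"
  assumes "finite K"
  shows "(\<integral>\<^sup>+w. ennreal ((cmod (\<Sum>k\<in>K. h k * character k w))\<^sup>2) \<partial>lebesgue_on torus)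
       = ennreal (\<Sum>k\<in>K. (cmod (h k))\<^sup>2)"
proof -
  let ?L = "lebesgue_on (torus :: (real^'n) set)"
  have eq: "complex_of_real ((cmod (\<Sum>k\<in>K. h k * character k w))\<^sup>2)
      = (\<Sum>k\<in>K. \<Sum>l\<in>K. h k * cnj (h l) * character (k - l) w)" for w
    by (simp only: complex_norm_square cnj_sum sum_product)
       (simp add: character_diff mult_ac)
  have "has_bochner_integral ?L (\<lambda>w. complex_of_real ((cmod (\<Sum>k\<in>K. h k * character k w))\<^sup>2))
      (\<Sum>k\<in>K. \<Sum>l\<in>K. h k * cnj (h l) * (if k - l = 0 then 1 else 0))"
    unfolding eq
    by (intro has_bochner_integral_sum has_bochner_integral_mult_right)
       (simp add: has_bochner_integral_iff integrable_character integral_character)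
  also have "(\<Sum>k\<in>K. \<Sum>l\<in>K. h k * cnj (h l) * (if k - l = 0 then 1 else 0))
      = complex_of_real (\<Sum>k\<in>K. (cmod (h k))\<^sup>2)"
    using assms by (simp add: if_distrib cong: if_cong) (simp add: complex_norm_square flip: of_real_power)
  finally have "has_bochner_integral ?L (\<lambda>w. (cmod (\<Sum>k\<in>K. h k * character k w))\<^sup>2) (\<Sum>k\<in>K. (cmod (h k))\<^sup>2)"
    by (auto dest: has_bochner_integral_Re)
  then show ?thesis
    by (subst nn_integral_eq_integral) (auto simp: has_bochner_integral_iff)
qed

section \<open>Absolutely convergent Fourier series and Bessel's inequality\<close>

lemma nn_integral_count_space_conv_infsum:
  fixes u :: "'a \<Rightarrow> real"
  assumes "u summable_on A" "\<And>x. x \<in> A \<Longrightarrow> u x \<ge> 0"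
  shows "(\<integral>\<^sup>+x. ennreal (u x) \<partial>count_space A) = ennreal (\<Sum>\<^sub>\<infinity>x\<in>A. u x)"
proof -
  have "(\<lambda>x. norm (u x)) summable_on A"
    using assms(1) by (rule summable_on_cong[THEN iffD1, rotated]) (simp add: assms(2))
  then have u: "Infinite_Set_Sum.abs_summable_on u A"
    by (rule abs_summable_equivalent[THEN iffD1])
  show ?thesis
    unfolding infsetsum_infsum[OF u, symmetric] by (rule nn_integral_conv_infsetsum[OF u assms(2)])
qed

text \<open>A uniform bound on finite partial sums already forces summability, so the Bessel
  inequality below has to be checked on finite index sets only.\<close>

lemma nn_integral_count_space_le:
  fixes u :: "'a \<Rightarrow> real"
  assumes nonneg: "\<And>x. u x \<ge> 0" and le: "\<And>K. finite K \<Longrightarrow> ennreal (sum u K) \<le> I"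
  shows "(\<integral>\<^sup>+x. ennreal (u x) \<partial>count_space UNIV) \<le> I"
proof (cases "I = \<infinity>")
  case False
  then obtain i where i: "I = ennreal i" "i \<ge> 0" by (cases I) auto
  have *: "sum u K \<le> i" if "finite K" for K
    using le[OF that] i by simp
  then have "u summable_on UNIV"
    by (intro nonneg_bdd_above_summable_on) (auto simp: nonneg bdd_above_def)
  moreover from this have "infsum u UNIV \<le> i"
    by (rule infsum_le_finite_sums) (auto intro: *)
  ultimately show ?thesis
    using i by (simp add: nn_integral_count_space_conv_infsum nonneg)
qed simp

text \<open>Weierstrass M-test with majorant \<open>cmod (h k)\<close>, because characters have
  modulus 1.\<close>

lemma uniform_limit_fourier_series:
  fixes h :: "int^'n::finite \<Rightarrow> complex"
  assumes "(\<lambda>k. cmod (h k)) summable_on UNIV"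
  shows "uniform_limit UNIV (\<lambda>K w. \<Sum>k\<in>K. h k * character k w)
    (\<lambda>w. \<Sum>\<^sub>\<infinity>k. h k * character k w) (finite_subsets_at_top UNIV)"
  by (rule Weierstrass_m_test_general[OF _ assms]) (simp add: norm_mult)

lemma continuous_fourier_series:
  fixes h :: "int^'n::finite \<Rightarrow> complex"
  assumes "(\<lambda>k. cmod (h k)) summable_on UNIV"
  shows "continuous_on UNIV (\<lambda>w. \<Sum>\<^sub>\<infinity>k. h k * character k w)"
  by (rule uniform_limit_theorem[OF _ uniform_limit_fourier_series[OF assms]])
     (auto intro!: always_eventually continuous_intros)

lemma cmod_fourier_series_le:
  fixes h :: "int^'n::finite \<Rightarrow> complex"
  assumes "(\<lambda>k. cmod (h k)) summable_on UNIV"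
  shows "cmod (\<Sum>\<^sub>\<infinity>k. h k * character k w) \<le> (\<Sum>\<^sub>\<infinity>k. cmod (h k))"
  using norm_infsum_bound[of "\<lambda>k. h k * character k w" UNIV] assms by (simp add: norm_mult)

text \<open>Finite partial sums satisfy Parseval exactly and approximate the series uniformly. On a
  torus of mass 1 the resulting error in energy is at most an arbitrary
  \<open>e > 0\<close>.\<close>

lemma bessel_fourier_series:
  fixes h :: "int^'n::finite \<Rightarrow> complex"
  assumes h: "(\<lambda>k. cmod (h k)) summable_on UNIV"
  shows "(\<integral>\<^sup>+k. ennreal ((cmod (h k))\<^sup>2) \<partial>count_space UNIV)
    \<le> (\<integral>\<^sup>+w. ennreal ((cmod (\<Sum>\<^sub>\<infinity>k. h k * character k w))\<^sup>2) \<partial>lebesgue_on torus)"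
proof (rule nn_integral_count_space_le)
  fix K :: "(int^'n) set" assume K: "finite K"
  define F where "F w = (\<Sum>\<^sub>\<infinity>k. h k * character k w)" for w
  define B where "B = (\<Sum>\<^sub>\<infinity>k. cmod (h k))"
  have B: "B \<ge> 0" "cmod (F w) \<le> B" for w
    using cmod_fourier_series_le[OF h] by (auto simp: B_def F_def intro: infsum_nonneg)
  have [measurable]: "F \<in> borel_measurable (lebesgue_on torus)"
    unfolding F_def using continuous_fourier_series[OF h]
    by (intro measurable_lebesgue_on_torus borel_measurable_continuous_onI)
  have "ennreal (\<Sum>k\<in>K. (cmod (h k))\<^sup>2) \<le> (\<integral>\<^sup>+w. ennreal ((cmod (F w))\<^sup>2) \<partial>lebesgue_on torus) + ennreal e"
    if "e > 0" for e
  proof -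
    \<comment> \<open>Chosen so that replacing \<open>cmod (F w)\<close> by
      \<open>cmod (F w) + d\<close> raises the square by at most \<open>(2 * B + 1) * d\<close>,
      which is at most \<open>e\<close>; the cap \<open>d \<le> 1\<close> provides the summand
      1.\<close>
    define d where "d = min 1 (e / (2 * B + 1))"
    have d: "d > 0" "d \<le> 1" "d \<le> e / (2 * B + 1)"
      using that B(1) by (auto simp: d_def)
    then have d': "(2 * B + 1) * d \<le> e"
      using B(1) by (simp add: pos_le_divide_eq mult.commute)
    have "\<forall>\<^sub>F Y in finite_subsets_at_top UNIV. \<forall>w. cmod ((\<Sum>k\<in>Y. h k * character k w) - F w) < d"
      using uniform_limitD[OF uniform_limit_fourier_series[OF h] d(1)] by (simp add: dist_norm F_def)
    then obtain X where "finite X" and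
      X: "\<forall>Y. finite Y \<and> X \<subseteq> Y \<and> Y \<subseteq> UNIV \<longrightarrow> (\<forall>w. cmod ((\<Sum>k\<in>Y. h k * character k w) - F w) < d)"
      unfolding eventually_finite_subsets_at_top by (elim exE conjE)
    \<comment> \<open>Containing \<open>X\<close> makes the sum close to \<open>F\<close>;
      containing \<open>K\<close> makes its coefficient energy dominate that of
      \<open>K\<close>.\<close>
    let ?S = "\<lambda>w. \<Sum>k\<in>X\<union>K. h k * character k w"
    have S: "(cmod (?S w))\<^sup>2 \<le> (cmod (F w))\<^sup>2 + e" for w
    proof -
      have "cmod (?S w) \<le> cmod (F w) + d"
      proof -
        have "cmod (?S w - F w) < d"
          using X \<open>finite X\<close> K by simp
        then show ?thesis
          using norm_triangle_ineq2[of "?S w" "F w"] by linarith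
      qed
      then have "(cmod (?S w))\<^sup>2 \<le> (cmod (F w) + d)\<^sup>2"
        by (rule power_mono) simp
      also have "\<dots> = (cmod (F w))\<^sup>2 + (2 * cmod (F w) + d) * d"
        by (simp add: power2_eq_square algebra_simps)
      also have "(2 * cmod (F w) + d) * d \<le> (2 * B + 1) * d"
        using B(2)[of w] d by (intro mult_right_mono) auto
      finally show ?thesis using d' by simp
    qed
    have "ennreal (\<Sum>k\<in>K. (cmod (h k))\<^sup>2) \<le> ennreal (\<Sum>k\<in>X\<union>K. (cmod (h k))\<^sup>2)"
      using \<open>finite X\<close> K by (intro ennreal_leI sum_mono2) auto
    also have "\<dots> = (\<integral>\<^sup>+w. ennreal ((cmod (?S w))\<^sup>2) \<partial>lebesgue_on torus)"
      using \<open>finite X\<close> K by (simp add: nn_integral_trigonometric_poly)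
    also have "\<dots> \<le> (\<integral>\<^sup>+w. ennreal ((cmod (F w))\<^sup>2) + ennreal e \<partial>lebesgue_on torus)"
      using S that by (intro nn_integral_mono) (simp flip: ennreal_plus)
    also have "\<dots> = (\<integral>\<^sup>+w. ennreal ((cmod (F w))\<^sup>2) \<partial>lebesgue_on torus) + ennreal e"
      by (subst nn_integral_add) (auto simp: emeasure_torus)
    finally show ?thesis .
  qed
  then show "ennreal (\<Sum>k\<in>K. (cmod (h k))\<^sup>2)
      \<le> (\<integral>\<^sup>+w. ennreal ((cmod (\<Sum>\<^sub>\<infinity>k. h k * character k w))\<^sup>2) \<partial>lebesgue_on torus)"
    unfolding F_def by (rule ennreal_le_epsilon)
qed simp

section \<open>Square-summable sequences: translation and Cauchy-Schwarz\<close>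

lemma sum_ell2_translate:
  fixes g :: "'a::group_add \<Rightarrow> complex"
  assumes "g \<in> ell2"
  shows "(\<lambda>k. (cmod (g (k - m)))\<^sup>2) summable_on UNIV"
    and "(\<Sum>\<^sub>\<infinity>k. (cmod (g (k - m)))\<^sup>2) = (\<Sum>\<^sub>\<infinity>k. (cmod (g k))\<^sup>2)"
proof -
  have bij: "bij_betw (\<lambda>k. k - m) UNIV UNIV"
    by (rule bij_betwI[where g="\<lambda>k. k + m"]) auto
  show "(\<lambda>k. (cmod (g (k - m)))\<^sup>2) summable_on UNIV"
    using assms summable_on_reindex_bij_betw[OF bij, of "\<lambda>k. (cmod (g k))\<^sup>2"] by (simp add: ell2_def)
  show "(\<Sum>\<^sub>\<infinity>k. (cmod (g (k - m)))\<^sup>2) = (\<Sum>\<^sub>\<infinity>k. (cmod (g k))\<^sup>2)"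
    using infsum_reindex_bij_betw[OF bij, of "\<lambda>k. (cmod (g k))\<^sup>2"] by simp
qed

text \<open>Applied to \<open>f\<close> and a conjugated translate of \<open>g\<close>, this
  provides the absolute summability assumed by the Fourier series lemmas.\<close>

lemma ell2_mult_abs_summable:
  assumes "f \<in> ell2" "g \<in> ell2"
  shows "(\<lambda>k. cmod (f k * g k)) summable_on UNIV"
proof (rule abs_summable_product)
  have *: "cmod (z * z) = (cmod z)\<^sup>2" for z
    by (simp add: norm_mult power2_eq_square)
  show "(\<lambda>k. cmod (f k * f k)) summable_on UNIV" "(\<lambda>k. cmod (g k * g k)) summable_on UNIV"
    using assms unfolding * ell2_def by simp_all
qed

lemma ell2_Cauchy_Schwarz:
  assumes f: "f \<in> ell2" and g: "g \<in> ell2"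
  shows "(\<Sum>\<^sub>\<infinity>k. cmod (f k * g k))\<^sup>2 \<le> (\<Sum>\<^sub>\<infinity>k. (cmod (f k))\<^sup>2) * (\<Sum>\<^sub>\<infinity>k. (cmod (g k))\<^sup>2)"
proof -
  let ?P = "(\<Sum>\<^sub>\<infinity>k. (cmod (f k))\<^sup>2) * (\<Sum>\<^sub>\<infinity>k. (cmod (g k))\<^sup>2)"
  have P: "0 \<le> ?P" by (intro mult_nonneg_nonneg infsum_nonneg) auto
  \<comment> \<open>The square root form bounds the sum itself, so it passes from finite partial
    sums to the infinite sum; squaring comes last.\<close>
  have "(\<Sum>\<^sub>\<infinity>k. cmod (f k * g k)) \<le> sqrt ?P"
  proof (rule infsum_le_finite_sums[OF ell2_mult_abs_summable[OF f g]])
    fix K :: "'a set" assume K: "finite K"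
    have "(\<Sum>k\<in>K. cmod (f k) * cmod (g k))\<^sup>2 \<le> (\<Sum>k\<in>K. (cmod (f k))\<^sup>2) * (\<Sum>k\<in>K. (cmod (g k))\<^sup>2)"
      by (rule Cauchy_Schwarz_ineq_sum)
    also have "\<dots> \<le> ?P"
      using f g K by (intro mult_mono finite_sum_le_infsum infsum_nonneg sum_nonneg) (auto simp: ell2_def)
    finally show "(\<Sum>k\<in>K. cmod (f k * g k)) \<le> sqrt ?P"
      by (simp add: norm_mult real_le_rsqrt)
  qed
  then have "(\<Sum>\<^sub>\<infinity>k. cmod (f k * g k))\<^sup>2 \<le> (sqrt ?P)\<^sup>2"
    by (intro power_mono infsum_nonneg) auto
  then show ?thesis using P by simp
qed

section \<open>Pointwise bound and energy of the STFT\<close>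

text \<open>For fixed \<open>m\<close> the STFT is a Fourier series in \<open>w\<close> with
  coefficients \<open>f k * cnj (g (k - m))\<close>; everything below rests on this view.\<close>

lemma STFT_eq: "STFT g f (m, w) = (\<Sum>\<^sub>\<infinity>k. f k * cnj (g (k - m)) * character k w)"
  by (simp only: STFT_def case_prod_conv exp_eq_character)

lemma cnj_translate_ell2:
  fixes g :: "'a::group_add \<Rightarrow> complex"
  assumes "g \<in> ell2" shows "(\<lambda>k. cnj (g (k - m))) \<in> ell2"
  using sum_ell2_translate(1)[OF assms] by (simp add: ell2_def)

text \<open>The first factor is countable, so slices suffice, and each slice is a continuous
  function of \<open>w\<close>.\<close>

lemma STFT_measurable:
  fixes f g :: "int^'n::finite \<Rightarrow> complex"
  assumes f: "f \<in> ell2" and g: "g \<in> ell2"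
  shows "STFT g f \<in> borel_measurable phase_space"
  unfolding phase_space_def
proof (rule measurable_pair_measure_countable1)
  fix m :: "int^'n"
  show "(\<lambda>w. STFT g f (m, w)) \<in> borel_measurable (lebesgue_on torus)"
    unfolding STFT_eq
    by (intro measurable_lebesgue_on_torus borel_measurable_continuous_onI continuous_fourier_series
        ell2_mult_abs_summable f cnj_translate_ell2 g)
qed simp

text \<open>The triangle inequality removes the characters and Cauchy-Schwarz applies. Translation
  preserves the norm of \<open>g\<close>, hence the bound is uniform in \<open>p\<close>.\<close>

lemma cmod_STFT_le:
  fixes f g :: "int^'n::finite \<Rightarrow> complex"
  assumes f: "f \<in> ell2" and g: "g \<in> ell2"
  shows "(cmod (STFT g f p))\<^sup>2 \<le> (\<Sum>\<^sub>\<infinity>k. (cmod (f k))\<^sup>2) * (\<Sum>\<^sub>\<infinity>k. (cmod (g k))\<^sup>2)"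
proof (cases p)
  case (Pair m w)
  have "(cmod (STFT g f p))\<^sup>2 \<le> (\<Sum>\<^sub>\<infinity>k. cmod (f k * cnj (g (k - m))))\<^sup>2"
    unfolding Pair STFT_eq
    by (intro power_mono cmod_fourier_series_le ell2_mult_abs_summable f cnj_translate_ell2 g) simp
  also have "\<dots> \<le> (\<Sum>\<^sub>\<infinity>k. (cmod (f k))\<^sup>2) * (\<Sum>\<^sub>\<infinity>k. (cmod (g k))\<^sup>2)"
    using ell2_Cauchy_Schwarz[OF f cnj_translate_ell2[OF g, of m]]
    by (simp add: sum_ell2_translate(2)[OF g])
  finally show ?thesis .
qed

text \<open>Bessel is applied on each slice \<open>m\<close> and summed over \<open>m\<close>. After
  exchanging the two sums, the inner sum over \<open>m\<close> is the full energy of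
  \<open>g\<close> for every \<open>k\<close>.\<close>

lemma STFT_energy_ge:
  fixes f g :: "int^'n::finite \<Rightarrow> complex"
  assumes f: "f \<in> ell2" and g: "g \<in> ell2"
  shows "ennreal ((\<Sum>\<^sub>\<infinity>k. (cmod (f k))\<^sup>2) * (\<Sum>\<^sub>\<infinity>k. (cmod (g k))\<^sup>2))
    \<le> (\<integral>\<^sup>+p. ennreal ((cmod (STFT g f p))\<^sup>2) \<partial>phase_space)"
proof -
  interpret finite_measure "lebesgue_on (torus :: (real^'n) set)" by (rule finite_measure_torus)
  have [measurable]: "STFT g f \<in> borel_measurable (count_space UNIV \<Otimes>\<^sub>M lebesgue_on torus)"
    using STFT_measurable[OF f g] by (simp only: phase_space_def)
  let ?G = "\<Sum>\<^sub>\<infinity>k. (cmod (g k))\<^sup>2"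
  have G: "(\<integral>\<^sup>+m. ennreal ((cmod (g (k - m)))\<^sup>2) \<partial>count_space UNIV) = ennreal ?G" for k
  proof -
    \<comment> \<open>The reflection is its own inverse.\<close>
    have "bij_betw (\<lambda>m. k - m) UNIV UNIV"
      by (rule bij_betwI[where g="\<lambda>m. k - m"]) auto
    from nn_integral_bij_count_space[OF this, of "\<lambda>m. ennreal ((cmod (g m))\<^sup>2)"] show ?thesis
      using g by (simp add: nn_integral_count_space_conv_infsum ell2_def)
  qed
  have "ennreal ((\<Sum>\<^sub>\<infinity>k. (cmod (f k))\<^sup>2) * ?G)
      = (\<integral>\<^sup>+k. ennreal ((cmod (f k))\<^sup>2) * ennreal ?G \<partial>count_space UNIV)"
    using f by (simp add: nn_integral_multc nn_integral_count_space_conv_infsum ell2_def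
        ennreal_mult infsum_nonneg)
  also have "\<dots> = (\<integral>\<^sup>+k. \<integral>\<^sup>+m. ennreal ((cmod (f k * cnj (g (k - m))))\<^sup>2) \<partial>count_space UNIV \<partial>count_space UNIV)"
    by (simp add: norm_mult power_mult_distrib ennreal_mult nn_integral_cmult G)
  also have "\<dots> = (\<integral>\<^sup>+m. \<integral>\<^sup>+k. ennreal ((cmod (f k * cnj (g (k - m))))\<^sup>2) \<partial>count_space UNIV \<partial>count_space UNIV)"
    by (rule nn_integral_count_space_nn_integral) auto
  also have "\<dots> \<le> (\<integral>\<^sup>+m. \<integral>\<^sup>+w. ennreal ((cmod (STFT g f (m, w)))\<^sup>2) \<partial>lebesgue_on torus \<partial>count_space UNIV)"
    unfolding STFT_eq
    by (intro nn_integral_mono bessel_fourier_series ell2_mult_abs_summable f cnj_translate_ell2 g)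
  also have "\<dots> = (\<integral>\<^sup>+p. ennreal ((cmod (STFT g f p))\<^sup>2) \<partial>phase_space)"
    unfolding phase_space_def by (intro nn_integral_fst) measurable
  finally show ?thesis .
qed

section \<open>Extended-valued square root\<close>

lemma ennsqrt_mono: "x \<le> y \<Longrightarrow> ennsqrt x \<le> ennsqrt y"
proof (cases "y = \<infinity>")
  case False
  then have "enn2real x \<le> enn2real y" if "x \<le> y"
    using that by (intro enn2real_mono) (auto simp: top.not_eq_extremum)
  moreover have "x \<noteq> \<infinity>" if "x \<le> y"
    using that False by (auto simp: top_unique)
  ultimately show "x \<le> y \<Longrightarrow> ennsqrt x \<le> ennsqrt y"
    using False by (simp add: ennsqrt_def ennreal_leI)
qed (simp add: ennsqrt_def)

lemma ennsqrt_ennreal: "x \<ge> 0 \<Longrightarrow> ennsqrt (ennreal x) = ennreal (sqrt x)"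
  by (simp add: ennsqrt_def)

lemma ennsqrt_eq_0_iff: "ennsqrt x = 0 \<longleftrightarrow> x = 0"
  by (auto simp: ennsqrt_def enn2real_eq_0_iff)

lemma ennsqrt_top: "ennsqrt top = top"
  by (simp add: ennsqrt_def)

text \<open>Holds without finiteness assumptions because the convention that 0 times infinity is 0
  is respected by both sides.\<close>

lemma ennsqrt_mult: "ennsqrt (x * y) = ennsqrt x * ennsqrt y"
proof (cases "x = \<infinity> \<or> y = \<infinity>")
  case True
  have *: "ennsqrt (\<infinity> * z) = ennsqrt \<infinity> * ennsqrt z" for z
    by (cases "z = 0") (simp_all add: ennsqrt_top ennsqrt_eq_0_iff[THEN iffD2] ennsqrt_eq_0_iff ennreal_top_mult)
  then show ?thesis
    using True *[of x] *[of y] by (elim disjE) (simp_all only: mult.commute)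
next
  case False
  then obtain a b where ab: "x = ennreal a" "a \<ge> 0" "y = ennreal b" "b \<ge> 0"
    by (cases x; cases y) auto
  have "ennsqrt (x * y) = ennreal (sqrt (a * b))"
    unfolding ab(1,3) ennreal_mult[OF ab(2,4), symmetric] using ab by (intro ennsqrt_ennreal) simp
  also have "\<dots> = ennreal (sqrt a) * ennreal (sqrt b)"
    unfolding real_sqrt_mult using ab by (intro ennreal_mult) simp_all
  also have "\<dots> = ennsqrt x * ennsqrt y"
    using ab by (simp only: ennsqrt_ennreal)
  finally show ?thesis .
qed

section \<open>The central cube and the weighted energy\<close>

text \<open>Half-width \<open>1/4\<close> gives volume \<open>(1/2) ^ CARD('n)\<close>, at most
  \<open>1/2\<close> in every dimension, and keeps the complement away from the origin.\<close>

definition central_cube :: "((int^'n) \<times> (real^'n::finite)) set" where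
  "central_cube = {0} \<times> {w. \<forall>i. - 1/4 \<le> w $ i \<and> w $ i \<le> 1/4}"

lemma central_cube_sets: "central_cube \<in> sets (phase_space :: ((int^'n) \<times> (real^'n::finite)) measure)"
  and emeasure_central_cube: "emeasure (phase_space :: ((int^'n) \<times> (real^'n::finite)) measure) central_cube \<le> 1/2"
proof -
  interpret finite_measure "lebesgue_on (torus :: (real^'n) set)" by (rule finite_measure_torus)
  let ?Q = "{w::real^'n. \<forall>i. - (1/4) \<le> w $ i \<and> w $ i \<le> 1/4}"
  have Q: "?Q \<in> sets borel"
    by measurable
  have "?Q \<subseteq> torus"
  proof
    fix w :: "real^'n" assume w: "w \<in> ?Q"
    have "- 1/2 \<le> w $ i \<and> w $ i < 1/2" for i
    proof -
      from w have "- (1/4) \<le> w $ i \<and> w $ i \<le> 1/4" by blast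
      then show ?thesis by linarith
    qed
    then show "w \<in> torus" by (simp add: torus_def)
  qed
  with Q have Q': "?Q \<in> sets (lebesgue_on torus)"
    by (auto simp: sets_restrict_space_iff torus_lebesgue sets_completionI_sets)
  show "central_cube \<in> sets (phase_space :: ((int^'n) \<times> (real^'n)) measure)"
    using Q' unfolding central_cube_def phase_space_def by (intro pair_measureI) auto
  have "emeasure (phase_space :: ((int^'n) \<times> (real^'n)) measure) central_cube = emeasure (lebesgue_on torus) ?Q"
    using Q' unfolding central_cube_def phase_space_def
    by (subst emeasure_pair_measure_Times) auto
  also have "\<dots> = emeasure lborel ?Q"
    using Q \<open>?Q \<subseteq> torus\<close> by (simp add: emeasure_restrict_space torus_lebesgue)
  also have "\<dots> = ennreal ((1/2) ^ CARD('n))"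
    by (subst emeasure_cube) auto
  \<comment> \<open>This is where the dimension being at least 1 enters.\<close>
  also have "\<dots> \<le> ennreal ((1/2) ^ 1)"
    by (intro ennreal_leI power_decreasing) (auto simp: Suc_le_eq)
  also have "\<dots> = 1/2"
    by (simp add: divide_ennreal flip: ennreal_1 ennreal_numeral)
  finally show "emeasure (phase_space :: ((int^'n) \<times> (real^'n)) measure) central_cube \<le> 1/2" .
qed

text \<open>Either some coordinate of \<open>m\<close> is a nonzero integer, which gives even norm
  at least 1, or \<open>m = 0\<close> and some coordinate of \<open>w\<close> leaves the
  cube.\<close>

lemma phase_norm_ge:
  assumes "p \<notin> central_cube"
  shows "phase_norm p \<ge> 1/4"
proof (cases p)
  case (Pair m w)
  have p: "phase_norm p \<ge> norm (real_vec m)" "phase_norm p \<ge> norm w"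
    by (auto simp: Pair phase_norm_def intro: real_le_rsqrt)
  show ?thesis
  proof (cases "m = 0")
    case False
    then obtain i where "m $ i \<noteq> 0" by (auto simp: vec_eq_iff)
    then have "1 \<le> \<bar>real_vec m $ i\<bar>" by (simp add: real_vec_def flip: of_int_abs)
    then show ?thesis using p(1) component_le_norm_cart[of "real_vec m" i] by linarith
  next
    case True
    then obtain i where "\<not> (- 1/4 \<le> w $ i \<and> w $ i \<le> 1/4)"
      using assms unfolding Pair central_cube_def by blast
    then have "\<bar>w $ i\<bar> \<ge> 1/4" by linarith
    then show ?thesis using p(2) component_le_norm_cart[of w i] by linarith
  qed
qed

lemma phase_norm_measurable:
  "(phase_norm :: (int^'n::finite) \<times> (real^'n) \<Rightarrow> real) \<in> borel_measurable phase_space"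
  unfolding phase_space_def
proof (rule measurable_pair_measure_countable1)
  fix m :: "int^'n"
  show "(\<lambda>w. phase_norm (m, w)) \<in> borel_measurable (lebesgue_on torus)"
    unfolding phase_norm_def case_prod_conv
    by (intro measurable_lebesgue_on_torus borel_measurable_continuous_onI continuous_intros)
qed simp

text \<open>The energy splits into the cube, which contributes at most half of the left-hand side,
  and its complement, where the weight is at least \<open>(1/4) powr s\<close>. The half is then
  absorbed on the left.\<close>

lemma STFT_energy_le_weighted:
  fixes f g :: "int^'n::finite \<Rightarrow> complex"
  assumes f: "f \<in> ell2" and g: "g \<in> ell2" and s: "s \<ge> 0"
  shows "ennreal ((\<Sum>\<^sub>\<infinity>k. (cmod (f k))\<^sup>2) * (\<Sum>\<^sub>\<infinity>k. (cmod (g k))\<^sup>2))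
    \<le> ennreal (2 * (4 powr s)\<^sup>2) *
      (\<integral>\<^sup>+p. ennreal ((cmod (complex_of_real (phase_norm p powr s) * STFT g f p))\<^sup>2) \<partial>phase_space)"
    (is "ennreal ?A \<le> _ * ?X")
proof (cases "?X = \<infinity>")
  case True
  then show ?thesis by (simp add: ennreal_mult_top)
next
  case False
  then obtain x where x: "?X = ennreal x" "x \<ge> 0" by (cases ?X) auto
  let ?W = "\<lambda>p. ennreal ((cmod (complex_of_real (phase_norm p powr s) * STFT g f p))\<^sup>2)"
  let ?C = "(4 powr s)\<^sup>2"
  have A: "?A \<ge> 0" by (intro mult_nonneg_nonneg infsum_nonneg) auto
  note [measurable] = STFT_measurable[OF f g] phase_norm_measurable central_cube_sets
  \<comment> \<open>On the cube the uniform bound is used, off the cube the weight; in each case the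
    other summand is merely nonnegative.\<close>
  have pw: "ennreal ((cmod (STFT g f p))\<^sup>2) \<le> ennreal ?A * indicator central_cube p + ennreal ?C * ?W p" for p
  proof (cases "p \<in> central_cube")
    case True
    have "ennreal ((cmod (STFT g f p))\<^sup>2) \<le> ennreal ?A"
      by (intro ennreal_leI cmod_STFT_le f g)
    also have "\<dots> \<le> ennreal ?A * indicator central_cube p + ennreal ?C * ?W p"
      using True by simp
    finally show ?thesis .
  next
    case False
    have "(1::real) = 4 powr s * (1/4) powr s"
      by (simp flip: powr_mult)
    also have "\<dots> \<le> 4 powr s * phase_norm p powr s"
      using phase_norm_ge[OF False] s by (intro mult_left_mono powr_mono2) auto
    finally have 1: "1 \<le> (4 powr s * phase_norm p powr s)\<^sup>2"
      by (rule one_le_power)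
    have "(cmod (STFT g f p))\<^sup>2 \<le> (4 powr s * phase_norm p powr s)\<^sup>2 * (cmod (STFT g f p))\<^sup>2"
      using mult_right_mono[OF 1, of "(cmod (STFT g f p))\<^sup>2"] by simp
    also have "\<dots> = ?C * (cmod (complex_of_real (phase_norm p powr s) * STFT g f p))\<^sup>2"
      by (simp add: norm_mult power_mult_distrib)
    finally have "ennreal ((cmod (STFT g f p))\<^sup>2) \<le> ennreal (?C * (cmod (complex_of_real (phase_norm p powr s) * STFT g f p))\<^sup>2)"
      by (rule ennreal_leI)
    then show ?thesis
      using False by (simp add: ennreal_mult')
  qed
  have "ennreal ?A \<le> (\<integral>\<^sup>+p. ennreal ((cmod (STFT g f p))\<^sup>2) \<partial>phase_space)"
    by (rule STFT_energy_ge[OF f g])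
  also have "\<dots> \<le> (\<integral>\<^sup>+p. ennreal ?A * indicator central_cube p + ennreal ?C * ?W p \<partial>phase_space)"
    by (intro nn_integral_mono pw)
  also have "\<dots> = ennreal ?A * emeasure phase_space (central_cube :: ((int^'n) \<times> (real^'n)) set) + ennreal ?C * ?X"
    by (subst nn_integral_add) (simp_all add: nn_integral_cmult)
  also have "\<dots> \<le> ennreal ?A * ennreal (1/2) + ennreal ?C * ennreal x"
    unfolding x(1) using emeasure_central_cube[where 'n='n]
    by (intro add_mono mult_left_mono) (auto simp: divide_ennreal simp flip: ennreal_1 ennreal_numeral)
  also have "\<dots> = ennreal (?A * (1/2) + ?C * x)"
    using A x(2) by (simp only: ennreal_mult[symmetric] ennreal_plus[symmetric] zero_le_power2 mult_nonneg_nonneg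
        zero_le_divide_1_iff zero_le_numeral)
  \<comment> \<open>Returning to real numbers permits subtracting half of \<open>?A\<close>; this is
    why infinite weighted energy was treated separately.\<close>
  finally have "?A \<le> ?A * (1/2) + ?C * x"
    using A x(2) by (subst (asm) ennreal_le_iff) auto
  then have "?A \<le> 2 * ?C * x" by simp
  then have "ennreal ?A \<le> ennreal (2 * ?C * x)" by (rule ennreal_leI)
  also have "\<dots> = ennreal (2 * ?C) * ennreal x"
    using x(2) by (intro ennreal_mult) auto
  finally show ?thesis unfolding x(1) .
qed

theorem theorem3p17:
  fixes s :: real
  assumes "s > 0"
  shows "\<exists>c::real. c > 0 \<and>
    (\<forall>(f :: int ^ 'n::finite \<Rightarrow> complex) g \<Sigma>.
      f \<in> ell2 \<longrightarrow> g \<in> ell2 \<longrightarrow>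
      \<Sigma> \<in> sets phase_space \<longrightarrow> emeasure phase_space \<Sigma> < \<infinity> \<longrightarrow>
      L2_enorm (restrict_space phase_space \<Sigma>) (STFT g f)
        \<le> ennreal c * ennsqrt (emeasure phase_space \<Sigma>) *
          L2_enorm phase_space (\<lambda>p. complex_of_real (phase_norm p powr s) * STFT g f p))"
proof (intro exI[of _ "sqrt 2 * 4 powr s"] conjI allI impI)
  \<comment> \<open>The witness is the square root of the factor
    \<open>2 * (4 powr s)\<^sup>2\<close> in \<open>STFT_energy_le_weighted\<close>.\<close>
  show "sqrt 2 * 4 powr s > 0" by simp
next
  fix f g :: "int ^ 'n \<Rightarrow> complex" and \<Sigma> :: "((int ^ 'n) \<times> (real ^ 'n)) set"
  assume f: "f \<in> ell2" and g: "g \<in> ell2" and \<Sigma>: "\<Sigma> \<in> sets phase_space"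
  let ?A = "(\<Sum>\<^sub>\<infinity>k. (cmod (f k))\<^sup>2) * (\<Sum>\<^sub>\<infinity>k. (cmod (g k))\<^sup>2)"
  let ?X = "\<integral>\<^sup>+p. ennreal ((cmod (complex_of_real (phase_norm p powr s) * STFT g f p))\<^sup>2) \<partial>phase_space"
  let ?c = "sqrt 2 * 4 powr s"
  have "(\<integral>\<^sup>+p. ennreal ((cmod (STFT g f p))\<^sup>2) \<partial>restrict_space phase_space \<Sigma>)
      = (\<integral>\<^sup>+p. ennreal ((cmod (STFT g f p))\<^sup>2) * indicator \<Sigma> p \<partial>phase_space)"
    using \<Sigma> by (intro nn_integral_restrict_space) simp
  also have "\<dots> \<le> (\<integral>\<^sup>+p. ennreal ?A * indicator \<Sigma> p \<partial>phase_space)"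
    by (intro nn_integral_mono mult_right_mono ennreal_leI cmod_STFT_le f g) simp
  also have "\<dots> = ennreal ?A * emeasure phase_space \<Sigma>"
    using \<Sigma> by (rule nn_integral_cmult_indicator)
  \<comment> \<open>The product of the energies of \<open>f\<close> and \<open>g\<close> is traded
    for the weighted energy, so no norm of \<open>f\<close> or \<open>g\<close> remains.\<close>
  also have "\<dots> \<le> ennreal (2 * (4 powr s)\<^sup>2) * ?X * emeasure phase_space \<Sigma>"
    by (intro mult_right_mono STFT_energy_le_weighted f g less_imp_le[OF assms]) simp
  finally have "L2_enorm (restrict_space phase_space \<Sigma>) (STFT g f)
      \<le> ennsqrt (ennreal (2 * (4 powr s)\<^sup>2) * ?X * emeasure phase_space \<Sigma>)"
    unfolding L2_enorm_def by (rule ennsqrt_mono)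
  also have "\<dots> = ennsqrt (ennreal (2 * (4 powr s)\<^sup>2)) * ennsqrt ?X * ennsqrt (emeasure phase_space \<Sigma>)"
    by (simp only: ennsqrt_mult)
  also have "ennsqrt (ennreal (2 * (4 powr s)\<^sup>2)) = ennreal ?c"
    by (subst ennsqrt_ennreal) (simp_all add: real_sqrt_mult)
  finally show "L2_enorm (restrict_space phase_space \<Sigma>) (STFT g f)
      \<le> ennreal ?c * ennsqrt (emeasure phase_space \<Sigma>) *
        L2_enorm phase_space (\<lambda>p. complex_of_real (phase_norm p powr s) * STFT g f p)"
    unfolding L2_enorm_def by (simp only: mult_ac)
qed

end
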